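(* Let $\mathcal{I}$ be an admissible ideal of $\mathbb{N}$. Let $(X,d)$ and $(Y,\rho)$ be two metric spaces, let $h:X\to Y$ be a uniform homeomorphism, and let $F=\{f_n\}_{n\in\mathbb{N}}$ (maps $f_n:X\to X$) and $G=\{g_n\}_{n\in\mathbb{N}}$ (maps $g_n:Y\to Y$) be uniformly $h$-conjugate. Let $f:X\to X$ and $g:Y\to Y$ be $h$-conjugate, i.e. $g(h(x))=h(f(x))$ for every $x\in X$. If $\{f_n\}_{n\in\mathbb{N}}$ $\mathcal{I}$-$\alpha$-converges to $f$, then $\{g_n\}_{n\in\mathbb{N}}$ $\mathcal{I}$-$\alpha$-converges to $g$.
   Context: An ideal of $\mathbb{N}$ (positive integers) is a family $\mathcal{I}\subset 2^{\mathbb{N}}$ such that $A,B\in\mathcal{I}$ implies $A\cup B\in\mathcal{I}$, and $A\in\mathcal{I}$, $B\subset A$ implies $B\in\mathcal{I}$; it is admissible if $\{n\}\in\mathcal{I}$ for every $n\in\mathbb{N}$. A homeomorphism $h:X\to Y$ is a uniform homeomorphism if $h$ is uniformly continuous on $X$ and $h^{-1}$ is uniformly continuous on $Y$. Sequences $F=\{f_n\}$ of maps $X\to X$ and $G=\{g_n\}$ of maps $Y\to Y$ are $h$-conjugate, for a homeomorphism $h:X\to Y$, if $g_k(h(x))=h(f_k(x))$ for every $k\in\mathbb{N}$ and every $x\in X$; they are uniformly $h$-conjugate if moreover $h$ is a uniform homeomorphism. A sequence $\{x_n\}$ in a metric space $(Z,\sigma)$ is $\mathcal{I}$-convergent to $z\in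 Z$ (written $x_n\xrightarrow{\mathcal{I}}z$) if $\{n\in\mathbb{N}:\sigma(x_n,z)\ge\varepsilon\}\in\mathcal{I}$ for every $\varepsilon>0$. A sequence of functions $f_n$ between two metric spaces $\mathcal{I}$-$\alpha$-converges to $f$ at $x_0$ if for every sequence $\{x_n\}$ in the domain with $x_n\xrightarrow{\mathcal{I}}x_0$ one has $f_n(x_n)\xrightarrow{\mathcal{I}}f(x_0)$; it $\mathcal{I}$-$\alpha$-converges to $f$ if it does so at every point $x_0$ of the domain. *)

theory Defs
  imports "HOL-Analysis.Analysis"
begin

text \<open>
  Metric spaces are values of the library type \<^typ>\<open>'a metric\<close>, with an explicit (possibly empty)
  carrier. The index set is \<open>{1..}\<close>, a set of natural numbers; the values of a sequence at index 0
  are never constrained or used.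
\<close>

definition ideal_of_positives :: "nat set set \<Rightarrow> bool" where
  "ideal_of_positives I \<longleftrightarrow>
     I \<subseteq> Pow {1..} \<and>
     (\<forall>A B. A \<in> I \<and> B \<in> I \<longrightarrow> A \<union> B \<in> I) \<and>
     (\<forall>A B. A \<in> I \<and> B \<subseteq> A \<longrightarrow> B \<in> I)"

text \<open>The improper ideal \<open>Pow {1..}\<close> is not excluded.\<close>

definition admissible_ideal :: "nat set set \<Rightarrow> bool" where
  "admissible_ideal I \<longleftrightarrow> ideal_of_positives I \<and> (\<forall>n\<ge>1. {n} \<in> I)"

definition uniform_homeomorphism :: "'a metric \<Rightarrow> 'b metric \<Rightarrow> ('a \<Rightarrow> 'b) \<Rightarrow> bool" where
  "uniform_homeomorphism X Y h \<longleftrightarrow>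
     homeomorphic_map (mtopology_of X) (mtopology_of Y) h \<and>
     uniformly_continuous_map X Y h \<and>
     uniformly_continuous_map Y X (inv_into (mspace X) h)"

definition conjugate_maps ::
  "'a metric \<Rightarrow> 'b metric \<Rightarrow> ('a \<Rightarrow> 'b) \<Rightarrow> ('a \<Rightarrow> 'a) \<Rightarrow> ('b \<Rightarrow> 'b) \<Rightarrow> bool" where
  "conjugate_maps X Y h f g \<longleftrightarrow>
     homeomorphic_map (mtopology_of X) (mtopology_of Y) h \<and>
     (\<forall>x\<in>mspace X. g (h x) = h (f x))"

definition conjugate_seqs ::
  "'a metric \<Rightarrow> 'b metric \<Rightarrow> ('a \<Rightarrow> 'b) \<Rightarrow> (nat \<Rightarrow> 'a \<Rightarrow> 'a) \<Rightarrow> (nat \<Rightarrow> 'b \<Rightarrow> 'b) \<Rightarrow> bool" where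
  "conjugate_seqs X Y h F G \<longleftrightarrow>
     homeomorphic_map (mtopology_of X) (mtopology_of Y) h \<and>
     (\<forall>k\<ge>1. \<forall>x\<in>mspace X. G k (h x) = h (F k x))"

definition uniformly_conjugate_seqs ::
  "'a metric \<Rightarrow> 'b metric \<Rightarrow> ('a \<Rightarrow> 'b) \<Rightarrow> (nat \<Rightarrow> 'a \<Rightarrow> 'a) \<Rightarrow> (nat \<Rightarrow> 'b \<Rightarrow> 'b) \<Rightarrow> bool" where
  "uniformly_conjugate_seqs X Y h F G \<longleftrightarrow>
     conjugate_seqs X Y h F G \<and> uniform_homeomorphism X Y h"

definition ideal_converges ::
  "nat set set \<Rightarrow> 'a metric \<Rightarrow> (nat \<Rightarrow> 'a) \<Rightarrow> 'a \<Rightarrow> bool" where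
  "ideal_converges I Z x z \<longleftrightarrow>
     (\<forall>n\<ge>1. x n \<in> mspace Z) \<and> z \<in> mspace Z \<and>
     (\<forall>\<epsilon>>0. {n \<in> {1..}. mdist Z (x n) z \<ge> \<epsilon>} \<in> I)"

definition ideal_alpha_converges_at ::
  "nat set set \<Rightarrow> 'a metric \<Rightarrow> 'b metric \<Rightarrow> (nat \<Rightarrow> 'a \<Rightarrow> 'b) \<Rightarrow> ('a \<Rightarrow> 'b) \<Rightarrow> 'a \<Rightarrow> bool" where
  "ideal_alpha_converges_at I X Y F f x0 \<longleftrightarrow>
     (\<forall>x. ideal_converges I X x x0 \<longrightarrow> ideal_converges I Y (\<lambda>n. F n (x n)) (f x0))"

definition ideal_alpha_converges ::
  "nat set set \<Rightarrow> 'a metric \<Rightarrow> 'b metric \<Rightarrow> (nat \<Rightarrow> 'a \<Rightarrow> 'b) \<Rightarrow> ('a \<Rightarrow> 'b) \<Rightarrow> bool" where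
  "ideal_alpha_converges I X Y F f \<longleftrightarrow> (\<forall>x0\<in>mspace X. ideal_alpha_converges_at I X Y F f x0)"

end

theory Submission
  imports Defs
begin

text \<open>
  Uniformly continuous maps preserve ideal convergence. A sequence converging in \<open>Y\<close> is therefore
  pulled back along the inverse of \<open>h\<close>, the hypothesis on \<open>F\<close> is applied in \<open>X\<close>, and the result is
  pushed forward along \<open>h\<close>; conjugacy identifies the outcome with the values of \<open>G\<close>.
\<close>

text \<open>If \<open>\<delta>\<close> answers \<open>\<epsilon>\<close> in the uniform continuity
  of \<open>k\<close>, the indices whose images are \<open>\<epsilon>\<close>-far from
  \<open>k z\<close> are among those whose points are \<open>\<delta>\<close>-far from
  \<open>z\<close>; an ideal is closed under subsets.\<close>

lemma ideal_converges_uniformly_continuous_image: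
  assumes I: "ideal_of_positives I"
    and k: "uniformly_continuous_map X Y k"
    and x: "ideal_converges I X x z"
  shows "ideal_converges I Y (\<lambda>n. k (x n)) (k z)"
  unfolding ideal_converges_def
proof (intro conjI allI impI)
  have xX: "\<And>n. n \<ge> 1 \<Longrightarrow> x n \<in> mspace X" and zX: "z \<in> mspace X"
    and small: "\<And>\<delta>. \<delta> > 0 \<Longrightarrow> {n \<in> {1..}. mdist X (x n) z \<ge> \<delta>} \<in> I"
    using x by (auto simp: ideal_converges_def)
  have kXY: "k \<in> mspace X \<rightarrow> mspace Y"
    using k by (simp add: uniformly_continuous_map_def)
  show "k (x n) \<in> mspace Y" if "n \<ge> 1" for n
    using kXY xX that by blast
  show "k z \<in> mspace Y"
    using kXY zX by blast
  fix \<epsilon> :: real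
  assume "\<epsilon> > 0"
  then obtain \<delta> where "\<delta> > 0"
    and \<delta>: "\<And>u v. \<lbrakk>u \<in> mspace X; v \<in> mspace X; mdist X v u < \<delta>\<rbrakk> \<Longrightarrow> mdist Y (k v) (k u) < \<epsilon>"
    using k unfolding uniformly_continuous_map_def by meson
  \<comment> \<open>Contrapositive of the choice of \<open>\<delta>\<close>, with
    \<open>u = z\<close> and \<open>v = x n\<close>.\<close>
  have "{n \<in> {1..}. mdist Y (k (x n)) (k z) \<ge> \<epsilon>} \<subseteq> {n \<in> {1..}. mdist X (x n) z \<ge> \<delta>}"
    using \<delta>[OF zX] xX by (force simp: not_less[symmetric])
  then show "{n \<in> {1..}. mdist Y (k (x n)) (k z) \<ge> \<epsilon>} \<in> I"
    using I small[OF \<open>\<delta> > 0\<close>] unfolding ideal_of_positives_def by blast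
qed

text \<open>Conjugacy determines terms only from index 1 on, so sequences that may differ at 0 have
  to be exchanged.\<close>

lemma ideal_converges_cong:
  assumes "\<And>n. n \<ge> 1 \<Longrightarrow> x n = y n"
  shows "ideal_converges I Z x z \<longleftrightarrow> ideal_converges I Z y z"
proof -
  have "{n \<in> {1..}. mdist Z (x n) z \<ge> \<epsilon>} = {n \<in> {1..}. mdist Z (y n) z \<ge> \<epsilon>}" for \<epsilon>
    using assms by auto
  then show ?thesis
    using assms by (simp add: ideal_converges_def)
qed

theorem theorem4p3:
  fixes I :: "nat set set"
    and X :: "'a metric" and Y :: "'b metric"
    and h :: "'a \<Rightarrow> 'b"
    and F :: "nat \<Rightarrow> 'a \<Rightarrow> 'a" and G :: "nat \<Rightarrow> 'b \<Rightarrow> 'b"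
    and f :: "'a \<Rightarrow> 'a" and g :: "'b \<Rightarrow> 'b"
  assumes "admissible_ideal I"
    and "uniform_homeomorphism X Y h"
    and "\<And>n. n \<ge> 1 \<Longrightarrow> F n \<in> mspace X \<rightarrow> mspace X"
    and "\<And>n. n \<ge> 1 \<Longrightarrow> G n \<in> mspace Y \<rightarrow> mspace Y"
    and "uniformly_conjugate_seqs X Y h F G"
    and "f \<in> mspace X \<rightarrow> mspace X"
    and "g \<in> mspace Y \<rightarrow> mspace Y"
    and "conjugate_maps X Y h f g"
    and "ideal_alpha_converges I X X F f"
  shows "ideal_alpha_converges I Y Y G g"
  unfolding ideal_alpha_converges_def ideal_alpha_converges_at_def
proof (intro ballI allI impI)
  fix y0 y
  assume y0: "y0 \<in> mspace Y" and y: "ideal_converges I Y y y0"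
  let ?k = "inv_into (mspace X) h"
  have I: "ideal_of_positives I"
    using assms(1) by (simp add: admissible_ideal_def)
  have h: "uniformly_continuous_map X Y h" and k: "uniformly_continuous_map Y X ?k"
    and "h ` mspace X = mspace Y"
    using assms(2) homeomorphic_imp_surjective_map
    by (fastforce simp: uniform_homeomorphism_def)+
  \<comment> \<open>Surjectivity of \<open>h\<close> puts \<open>w\<close> in the image of
    \<open>mspace X\<close>, where \<open>inv_into\<close> picks a preimage.\<close>
  then have hk: "h (?k w) = w" and kX: "?k w \<in> mspace X" if "w \<in> mspace Y" for w
    using that by (auto simp: f_inv_into_f inv_into_into)
  have "ideal_converges I X (\<lambda>n. ?k (y n)) (?k y0)"
    by (rule ideal_converges_uniformly_continuous_image[OF I k y])
  then have "ideal_converges I X (\<lambda>n. F n (?k (y n))) (f (?k y0))"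
    using assms(9) kX[OF y0] by (simp add: ideal_alpha_converges_def ideal_alpha_converges_at_def)
  then have "ideal_converges I Y (\<lambda>n. h (F n (?k (y n)))) (h (f (?k y0)))"
    by (rule ideal_converges_uniformly_continuous_image[OF I h])
  \<comment> \<open>Conjugacy at the point \<open>?k (y n)\<close>, which \<open>h\<close> sends
    back to \<open>y n\<close>; the bound on \<open>n\<close> guarantees that \<open>y n\<close>
    lies in \<open>mspace Y\<close>.\<close>
  moreover have "h (F n (?k (y n))) = G n (y n)" if "n \<ge> 1" for n
  proof -
    have "y n \<in> mspace Y"
      using y that by (simp add: ideal_converges_def)
    then show ?thesis
      using assms(5) that hk kX
      unfolding uniformly_conjugate_seqs_def conjugate_seqs_def by metis
  qed
  moreover have "h (f (?k y0)) = g y0"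
    using assms(8) hk[OF y0] kX[OF y0] unfolding conjugate_maps_def by metis
  ultimately show "ideal_converges I Y (\<lambda>n. G n (y n)) (g y0)"
    using ideal_converges_cong[of "\<lambda>n. h (F n (?k (y n)))" "\<lambda>n. G n (y n)"] by simp
qed

end
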